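(* The following conditions are equivalent for a locale $L$: (i) $L$ is hereditarily IDM; (ii) $(\bigwedge a_i)\to b\le\bigvee(a_i\to b)$ for all $b\in L$ and all $\{a_i\}_{i\in I}\subseteq L$; (iii) $(\bigwedge a_i)\to b\le\bigvee(a_i\to b)$ for all $b\in L$ and all $\{a_i\}_{i\in I}\subseteq\mathfrak{c}(b)$.
   Context: A locale (= frame) is a complete lattice $L$ with $a\wedge\bigvee B=\bigvee\{a\wedge b\mid b\in B\}$ for all $a\in L$, $B\subseteq L$. It is a complete Heyting algebra with Heyting operation $\to$; the pseudocomplement of $a$ is $a^*=a\to 0$. Joins and meets without displayed index are taken over $i\in I$. A sublocale of $L$ is a subset $S\subseteq L$ closed under arbitrary meets in $L$ and such that $a\to s\in S$ for all $a\in L$, $s\in S$; with the induced order $S$ is itself a locale. For $b\in L$, $\mathfrak{c}(b)=\{x\in L\mid x\ge b\}$ is the closed sublocale determined by $b$. A locale $M$ is IDM (infinitely De Morgan) if $(\bigwedge a_i)^*\le\bigvee a_i^*$ for all $\{a_i\}_{i\in I}\subseteq M$, with operations computed in $M$. $L$ is hereditarily IDM if every sublocale of $L$ is IDM.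
   Formalization: In (ii) and (iii) the families {a_i} are taken to be nonempty; for empty I the inequality reads b ≤ 0 for all b, which fails in the two-element locale although it is hereditarily IDM. *)

theory Defs
  imports "HOL-Algebra.Complete_Lattice"
begin

locale frame = complete_lattice +
  assumes meet_sup_distrib:
    "\<lbrakk>a \<in> carrier L; B \<subseteq> carrier L\<rbrakk> \<Longrightarrow> a \<sqinter> \<Squnion>B = \<Squnion>((\<lambda>b. a \<sqinter> b) ` B)"

definition heyting_imp :: "[_, 'a, 'a] \<Rightarrow> 'a" (infixr \<open>\<rightarrow>\<index>\<close> 60)
  where "a \<rightarrow>\<^bsub>L\<^esub> b = \<Squnion>\<^bsub>L\<^esub>{x \<in> carrier L. x \<sqinter>\<^bsub>L\<^esub> a \<sqsubseteq>\<^bsub>L\<^esub> b}"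

lemma (in frame) heyting_imp_residuation:
  assumes "a \<in> carrier L" "b \<in> carrier L" "c \<in> carrier L"
  shows "c \<sqsubseteq> a \<rightarrow> b \<longleftrightarrow> c \<sqinter> a \<sqsubseteq> b"
proof -
  let ?X = "{x \<in> carrier L. x \<sqinter> a \<sqsubseteq> b}"
  have X: "?X \<subseteq> carrier L" by auto
  have imp: "a \<rightarrow> b = \<Squnion>?X" by (simp add: heyting_imp_def)
  have imp_closed: "a \<rightarrow> b \<in> carrier L" unfolding imp by (rule sup_closed[OF X])
  show ?thesis
  proof
    assume "c \<sqinter> a \<sqsubseteq> b"
    with assms X show "c \<sqsubseteq> a \<rightarrow> b" unfolding imp by (intro sup_upper) auto
  next
    assume c: "c \<sqsubseteq> a \<rightarrow> b"
    have "a \<sqinter> (a \<rightarrow> b) = \<Squnion>((\<lambda>x. a \<sqinter> x) ` ?X)"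
      unfolding imp by (rule meet_sup_distrib[OF assms(1) X])
    also have "\<dots> \<sqsubseteq> b"
      using assms by (intro sup_least) (auto simp: meet_comm)
    finally have "a \<sqinter> (a \<rightarrow> b) \<sqsubseteq> b" .
    moreover have "c \<sqinter> a \<sqsubseteq> a \<sqinter> (a \<rightarrow> b)"
    proof (rule meet_le)
      show "c \<sqinter> a \<sqsubseteq> a" by (rule meet_right[OF assms(3,1)])
      show "c \<sqinter> a \<sqsubseteq> a \<rightarrow> b"
        by (rule le_trans[OF meet_left[OF assms(3,1)] c]) (simp_all add: assms imp_closed)
    qed (simp_all add: assms imp_closed)
    ultimately show "c \<sqinter> a \<sqsubseteq> b"
      using le_trans[of "c \<sqinter> a" "a \<sqinter> (a \<rightarrow> b)" b] by (simp add: assms imp_closed)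
  qed
qed

definition pseudocomplement :: "[_, 'a] \<Rightarrow> 'a"
  where "pseudocomplement L a = a \<rightarrow>\<^bsub>L\<^esub> \<bottom>\<^bsub>L\<^esub>"

text \<open>Families enter a meet or a join only through their range, so here and below they are
  represented by subsets of the carrier.\<close>

definition IDM :: "('a, 'b) gorder_scheme \<Rightarrow> bool"
  where "IDM M \<longleftrightarrow> (\<forall>A \<subseteq> carrier M.
    pseudocomplement M (\<Sqinter>\<^bsub>M\<^esub>A) \<sqsubseteq>\<^bsub>M\<^esub> \<Squnion>\<^bsub>M\<^esub>(pseudocomplement M ` A))"

definition is_sublocale :: "('a, 'b) gorder_scheme \<Rightarrow> 'a set \<Rightarrow> bool"
  where "is_sublocale L S \<longleftrightarrow>
    S \<subseteq> carrier L \<and>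
    (\<forall>A \<subseteq> S. \<Sqinter>\<^bsub>L\<^esub>A \<in> S) \<and>
    (\<forall>a \<in> carrier L. \<forall>s \<in> S. a \<rightarrow>\<^bsub>L\<^esub> s \<in> S)"

definition closed_sublocale :: "('a, 'b) gorder_scheme \<Rightarrow> 'a \<Rightarrow> 'a set"
  where "closed_sublocale L b = {x \<in> carrier L. b \<sqsubseteq>\<^bsub>L\<^esub> x}"

text \<open>Replacing the carrier gives \<open>S\<close> the induced order, and all lattice operations and the
  pseudocomplement in \<^const>\<open>IDM\<close> are then recomputed inside \<open>S\<close>.\<close>

definition hereditarily_IDM :: "('a, 'b) gorder_scheme \<Rightarrow> bool"
  where "hereditarily_IDM L \<longleftrightarrow> (\<forall>S. is_sublocale L S \<longrightarrow> IDM (L\<lparr>carrier := S\<rparr>))"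

text \<open>The inequality \<open>(\<Sqinter>A) \<rightarrow> b \<sqsubseteq> \<Squnion>((\<lambda>a. a \<rightarrow> b) ` A)\<close>, which characterises hereditary IDM,
  is to be read for nonempty \<open>A\<close>: for \<open>A = {}\<close> it says \<open>b = \<bottom>\<close>, and requiring this for all \<open>b\<close>
  would leave only the trivial locale.  The empty family is harmless in \<^const>\<open>IDM\<close>, in the frame
  law, and in \<^const>\<open>is_sublocale\<close> (where it gives \<open>\<top> \<in> S\<close>), and is admitted there.\<close>

end

(* Meets and the Heyting operation of a sublocale S are those of L, and joins in S lie above the
   joins in L; hence (ii), applied with b the bottom of S, gives (i). Conversely b is the bottom
   of the closed sublocale of b, where nonempty joins are those of L, so (i) gives (iii). Finally
   a family A and an element b may be replaced by A and b' = b /\ (meet of A): b' lies below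
   A, the left-hand side of (ii) is unchanged and the right-hand side only decreases. *)

theory Submission
  imports Defs
begin

section \<open>Heyting implication in a frame, and closed sublocales\<close>

context frame
begin

lemma heyting_imp_closed [simp, intro]: "a \<rightarrow> b \<in> carrier L"
  unfolding heyting_imp_def by (rule sup_closed) auto

lemma heyting_imp_mono:
  assumes "a \<in> carrier L" "b \<in> carrier L" "c \<in> carrier L" "b \<sqsubseteq> c"
  shows "a \<rightarrow> b \<sqsubseteq> a \<rightarrow> c"
proof -
  \<comment> \<open>Modus ponens: residuation applied to \<open>a \<rightarrow> b\<close>
    itself.\<close>
  have "(a \<rightarrow> b) \<sqinter> a \<sqsubseteq> b"
    using assms heyting_imp_residuation[of a b "a \<rightarrow> b"] by simp
  then have "(a \<rightarrow> b) \<sqinter> a \<sqsubseteq> c"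
    using assms le_trans[of "(a \<rightarrow> b) \<sqinter> a" b c] by simp
  then show ?thesis
    using assms heyting_imp_residuation[of a c "a \<rightarrow> b"] by simp
qed

lemma le_heyting_imp:
  assumes "a \<in> carrier L" "b \<in> carrier L"
  shows "b \<sqsubseteq> a \<rightarrow> b"
  using assms by (simp add: heyting_imp_residuation meet_left)

text \<open>Settles the empty family, whose meet is \<open>\<top>\<close>.\<close>

lemma top_heyting_imp_le:
  assumes "b \<in> carrier L"
  shows "\<top> \<rightarrow> b \<sqsubseteq> b"
proof -
  have "(\<top> \<rightarrow> b) \<sqinter> \<top> \<sqsubseteq> b"
    using assms heyting_imp_residuation[of \<top> b "\<top> \<rightarrow> b"] by simp
  moreover have "\<top> \<rightarrow> b \<sqsubseteq> (\<top> \<rightarrow> b) \<sqinter> \<top>"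
    by (rule meet_le) simp_all
  ultimately show ?thesis
    using assms le_trans[of "\<top> \<rightarrow> b" "(\<top> \<rightarrow> b) \<sqinter> \<top>" b] by simp
qed

text \<open>By modus ponens \<open>(a \<rightarrow> b) \<sqinter> a\<close> lies below
  \<open>b\<close>, and it lies below \<open>a\<close> anyway. The meet binds tighter than the
  arrow, so the right-hand side is \<open>a \<rightarrow> (b \<sqinter> a)\<close>. This permits
  lowering \<open>b\<close> beneath a given family.\<close>

lemma heyting_imp_le_imp_meet:
  assumes "a \<in> carrier L" "b \<in> carrier L"
  shows "a \<rightarrow> b \<sqsubseteq> a \<rightarrow> b \<sqinter> a"
proof -
  have "(a \<rightarrow> b) \<sqinter> a \<sqsubseteq> b"
    using assms heyting_imp_residuation[of a b "a \<rightarrow> b"] by simp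
  then have "(a \<rightarrow> b) \<sqinter> a \<sqsubseteq> b \<sqinter> a"
    using assms by (intro meet_le) (simp_all add: meet_right)
  then show ?thesis
    using assms heyting_imp_residuation[of a "b \<sqinter> a" "a \<rightarrow> b"] by simp
qed

text \<open>Closure under implication comes from \<open>s \<sqsubseteq> a \<rightarrow> s\<close>:
  an implication never drops below its conclusion, hence not below \<open>b\<close>.\<close>

lemma is_sublocale_closed_sublocale:
  assumes b: "b \<in> carrier L"
  shows "is_sublocale L (closed_sublocale L b)"
  unfolding is_sublocale_def
proof (intro conjI allI ballI impI)
  show "closed_sublocale L b \<subseteq> carrier L"
    by (auto simp: closed_sublocale_def)
  show "\<Sqinter>A \<in> closed_sublocale L b" if "A \<subseteq> closed_sublocale L b" for A
  proof -
    have "A \<subseteq> carrier L" "\<And>x. x \<in> A \<Longrightarrow> b \<sqsubseteq> x"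
      using that by (auto simp: closed_sublocale_def)
    then show ?thesis
      using b by (auto simp: closed_sublocale_def intro: inf_greatest)
  qed
  show "a \<rightarrow> s \<in> closed_sublocale L b"
    if "a \<in> carrier L" "s \<in> closed_sublocale L b" for a s
  proof -
    have s: "s \<in> carrier L" "b \<sqsubseteq> s"
      using that by (auto simp: closed_sublocale_def)
    then have "b \<sqsubseteq> a \<rightarrow> s"
      using that b le_heyting_imp[of a s] le_trans[of b s "a \<rightarrow> s"] by simp
    then show ?thesis
      by (simp add: closed_sublocale_def)
  qed
qed

end

section \<open>Lattice operations of a sublocale compared with those of the frame\<close>

locale frame_sublocale = frame +
  fixes S
  assumes is_sublocale: "is_sublocale L S"
begin

abbreviation M where "M \<equiv> L\<lparr>carrier := S\<rparr>"

lemma sub_carrier: "S \<subseteq> carrier L"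
  and Inf_in: "A \<subseteq> S \<Longrightarrow> \<Sqinter>A \<in> S"
  and imp_in: "a \<in> carrier L \<Longrightarrow> s \<in> S \<Longrightarrow> a \<rightarrow> s \<in> S"
  using is_sublocale unfolding is_sublocale_def by auto

lemma in_carrier: "x \<in> S \<Longrightarrow> x \<in> carrier L"
  using sub_carrier by auto

lemma greatest_Inf_sub:
  assumes "A \<subseteq> S"
  shows "greatest M (\<Sqinter>A) (Lower M A)"
proof -
  have "A \<subseteq> carrier L"
    using assms sub_carrier by blast
  moreover have "y \<sqsubseteq> \<Sqinter>A" if "y \<in> Lower M A" for y
    using that assms \<open>A \<subseteq> carrier L\<close>
    by (intro inf_greatest) (auto simp: Lower_def in_carrier)
  ultimately show ?thesis
    using assms Inf_in by (intro greatest_LowerI) (auto intro: inf_lower)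
qed

lemma partial_order_sub: "partial_order M"
  by standard (auto simp: in_carrier eq_is_equal intro: le_antisym le_trans)

lemma complete_lattice_sub: "complete_lattice M"
proof -
  interpret M: partial_order M
    by (rule partial_order_sub)
  show ?thesis
  proof (rule M.complete_lattice_criterion1)
    show "\<exists>g. greatest M g (carrier M)"
      \<comment> \<open>Every element of \<open>S\<close> is a lower bound of the empty set, so the
        empty meet is the top of \<open>M\<close>.\<close>
      using greatest_Inf_sub[of "{}"] by auto
    show "\<exists>i. greatest M i (Lower M A)" if "A \<subseteq> carrier M" for A
      using greatest_Inf_sub[of A] that by auto
  qed
qed

sublocale M: complete_lattice M
  by (rule complete_lattice_sub)

lemma Inf_sub:
  assumes "A \<subseteq> S"
  shows "\<Sqinter>\<^bsub>M\<^esub>A = \<Sqinter>A"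
  using M.greatest_unique[OF M.inf_glb greatest_Inf_sub] assms by simp

lemma meet_sub: "a \<in> S \<Longrightarrow> b \<in> S \<Longrightarrow> a \<sqinter>\<^bsub>M\<^esub> b = a \<sqinter> b"
  by (simp add: meet_def Inf_sub)

text \<open>The join in \<open>M\<close> is also an upper bound in \<open>L\<close>. It may be
  strictly larger than the join in \<open>L\<close>, since the latter can fall outside
  \<open>S\<close>.\<close>

lemma Sup_le_Sup_sub:
  assumes "A \<subseteq> S"
  shows "\<Squnion>A \<sqsubseteq> \<Squnion>\<^bsub>M\<^esub>A"
proof (rule sup_least)
  show "A \<subseteq> carrier L"
    using assms sub_carrier by blast
  show "\<Squnion>\<^bsub>M\<^esub>A \<in> carrier L"
    using M.sup_closed[of A] assms in_carrier by simp
  show "x \<sqsubseteq> \<Squnion>\<^bsub>M\<^esub>A" if "x \<in> A" for x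
    using M.sup_upper[of A x] assms that by simp
qed

lemma Sup_sub_le_Sup:
  assumes "A \<subseteq> S" "\<Squnion>A \<in> S"
  shows "\<Squnion>\<^bsub>M\<^esub>A \<sqsubseteq> \<Squnion>A"
proof -
  have "A \<subseteq> carrier L"
    using assms sub_carrier by blast
  then show ?thesis
    using M.sup_least[of A "\<Squnion>A"] assms sup_upper by simp
qed

text \<open>The implication of \<open>M\<close> is a join in \<open>M\<close>, and joins in
  \<open>M\<close> and \<open>L\<close> may differ. Here the set being joined has a greatest
  element, \<open>a \<rightarrow> b\<close>, which lies in \<open>S\<close>; a greatest element is
  the join in either order.\<close>

lemma heyting_imp_sub:
  assumes "a \<in> S" "b \<in> S"
  shows "a \<rightarrow>\<^bsub>M\<^esub> b = a \<rightarrow> b"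
proof -
  let ?X = "{x \<in> S. x \<sqinter> a \<sqsubseteq> b}"
  have X: "?X = {x \<in> carrier M. x \<sqinter>\<^bsub>M\<^esub> a \<sqsubseteq>\<^bsub>M\<^esub> b}"
    using assms by (auto simp: meet_sub)
  have "a \<rightarrow> b \<in> ?X"
    using assms heyting_imp_residuation[of a b "a \<rightarrow> b"] by (simp add: in_carrier imp_in)
  moreover have "x \<sqsubseteq> a \<rightarrow> b" if "x \<in> ?X" for x
    using that assms by (simp add: heyting_imp_residuation in_carrier)
  ultimately have "least M (a \<rightarrow> b) (Upper M ?X)"
    by (intro least_UpperI) (auto simp: Upper_def)
  moreover have "least M (\<Squnion>\<^bsub>M\<^esub>?X) (Upper M ?X)"
    by (rule M.sup_lub) auto
  ultimately show ?thesis
    using M.least_unique unfolding heyting_imp_def[of M] X by blast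
qed

lemma pseudocomplement_sub: "a \<in> S \<Longrightarrow> pseudocomplement M a = a \<rightarrow> \<bottom>\<^bsub>M\<^esub>"
  using M.bottom_closed by (simp add: pseudocomplement_def heyting_imp_sub)

text \<open>Meets and implications are now taken in \<open>L\<close>; only the bottom and the join
  still depend on \<open>M\<close>.\<close>

lemma IDM_sub_iff:
  "IDM M \<longleftrightarrow> (\<forall>A \<subseteq> S. (\<Sqinter>A) \<rightarrow> \<bottom>\<^bsub>M\<^esub> \<sqsubseteq> \<Squnion>\<^bsub>M\<^esub>((\<lambda>a. a \<rightarrow> \<bottom>\<^bsub>M\<^esub>) ` A))"
proof -
  have "pseudocomplement M ` A = (\<lambda>a. a \<rightarrow> \<bottom>\<^bsub>M\<^esub>) ` A" if "A \<subseteq> S" for A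
    using that by (intro image_cong) (auto simp: pseudocomplement_sub)
  then show ?thesis
    by (auto simp: IDM_def Inf_sub pseudocomplement_sub Inf_in)
qed

lemma IDM_sub:
  assumes "\<And>b A. b \<in> carrier L \<Longrightarrow> A \<subseteq> carrier L \<Longrightarrow> A \<noteq> {} \<Longrightarrow>
    (\<Sqinter>A) \<rightarrow> b \<sqsubseteq> \<Squnion>((\<lambda>a. a \<rightarrow> b) ` A)"
  shows "IDM M"
  unfolding IDM_sub_iff
proof (intro allI impI)
  fix A
  assume A: "A \<subseteq> S"
  let ?b = "\<bottom>\<^bsub>M\<^esub>"
  let ?J = "(\<lambda>a. a \<rightarrow> ?b) ` A"
  have b: "?b \<in> S"
    using M.bottom_closed by simp
  have J: "?J \<subseteq> S"
    using A b by (auto simp: in_carrier imp_in)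
  have JS: "\<Squnion>\<^bsub>M\<^esub>?J \<in> S"
    using M.sup_closed[of ?J] J by simp
  have AL: "A \<subseteq> carrier L"
    using A sub_carrier by blast
  show "(\<Sqinter>A) \<rightarrow> ?b \<sqsubseteq> \<Squnion>\<^bsub>M\<^esub>?J"
  proof (cases "A = {}")
    \<comment> \<open>For the empty family the left-hand side is
      \<open>\<top> \<rightarrow> ?b\<close>, which lies below the bottom \<open>?b\<close> of
      \<open>M\<close>, so the assumption on nonempty families is not called upon.\<close>
    case True
    have "\<Sqinter>{} = \<top>"
      using weak_inf_empty by (simp only: eq_is_equal)
    then have "(\<Sqinter>{}) \<rightarrow> ?b \<sqsubseteq> ?b"
      using b top_heyting_imp_le in_carrier by simp
    moreover have "?b \<sqsubseteq> \<Squnion>\<^bsub>M\<^esub>?J"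
      using M.bottom_lower[of "\<Squnion>\<^bsub>M\<^esub>?J"] JS by simp
    ultimately show ?thesis
      using True b JS in_carrier le_trans[of "(\<Sqinter>{}) \<rightarrow> ?b" ?b "\<Squnion>\<^bsub>M\<^esub>?J"] by simp
  next
    case False
    then have "(\<Sqinter>A) \<rightarrow> ?b \<sqsubseteq> \<Squnion>?J"
      using assms b AL in_carrier by simp
    moreover have "\<Squnion>?J \<in> carrier L"
      by (rule sup_closed) auto
    ultimately show ?thesis
      using Sup_le_Sup_sub[OF J] JS in_carrier by (blast intro: le_trans[of _ "\<Squnion>?J"])
  qed
qed

end

section \<open>Closed sublocales, and the reduction of arbitrary families to them\<close>

context frame
begin

lemma IDM_closed_sublocaleD:
  assumes b: "b \<in> carrier L"
    and IDM: "IDM (L\<lparr>carrier := closed_sublocale L b\<rparr>)"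
    and A: "A \<subseteq> closed_sublocale L b" "A \<noteq> {}"
  shows "(\<Sqinter>A) \<rightarrow> b \<sqsubseteq> \<Squnion>((\<lambda>a. a \<rightarrow> b) ` A)"
proof -
  interpret frame_sublocale L "closed_sublocale L b"
    by unfold_locales (rule is_sublocale_closed_sublocale[OF b])
  let ?J = "(\<lambda>a. a \<rightarrow> b) ` A"
  have b_in: "b \<in> closed_sublocale L b"
    using b by (simp add: closed_sublocale_def)
  have bot: "\<bottom>\<^bsub>M\<^esub> = b"
  proof -
    have "least M b (carrier M)"
      using b_in by (auto simp: least_def closed_sublocale_def)
    then show ?thesis
      using M.least_unique M.bottom_least by blast
  qed
  have J: "?J \<subseteq> closed_sublocale L b"
    using A b_in by (auto simp: in_carrier imp_in)
  have JL: "?J \<subseteq> carrier L"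
    by auto
  \<comment> \<open>Nonemptiness enters here: a single member \<open>a \<rightarrow> b\<close>
    already lifts the join above \<open>b\<close>. The join in \<open>L\<close> thus stays in the
    sublocale and bounds the join in \<open>M\<close>.\<close>
  have Sup_in: "\<Squnion>?J \<in> closed_sublocale L b"
  proof -
    obtain a where "a \<in> A"
      using A by blast
    then have "a \<rightarrow> b \<sqsubseteq> \<Squnion>?J" "b \<sqsubseteq> a \<rightarrow> b"
      using A b JL le_heyting_imp in_carrier by (auto intro: sup_upper)
    then have "b \<sqsubseteq> \<Squnion>?J"
      using b JL sup_closed by (blast intro: le_trans[of _ "a \<rightarrow> b"])
    then show ?thesis
      using JL by (simp add: closed_sublocale_def)
  qed
  have "(\<Sqinter>A) \<rightarrow> b \<sqsubseteq> \<Squnion>\<^bsub>M\<^esub>?J"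
    using IDM A unfolding IDM_sub_iff bot by blast
  moreover have "\<Squnion>\<^bsub>M\<^esub>?J \<in> carrier L"
    using M.sup_closed[of ?J] J in_carrier by simp
  ultimately show ?thesis
    using Sup_sub_le_Sup[OF J Sup_in] Sup_in in_carrier
    by (blast intro: le_trans[of _ "\<Squnion>\<^bsub>M\<^esub>?J"])
qed

lemma Inf_imp_le_of_closed_sublocales:
  assumes closed: "\<And>b A. b \<in> carrier L \<Longrightarrow> A \<subseteq> closed_sublocale L b \<Longrightarrow> A \<noteq> {} \<Longrightarrow>
      (\<Sqinter>A) \<rightarrow> b \<sqsubseteq> \<Squnion>((\<lambda>a. a \<rightarrow> b) ` A)"
    and b: "b \<in> carrier L" and A: "A \<subseteq> carrier L" "A \<noteq> {}"
  shows "(\<Sqinter>A) \<rightarrow> b \<sqsubseteq> \<Squnion>((\<lambda>a. a \<rightarrow> b) ` A)"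
proof -
  let ?c = "b \<sqinter> \<Sqinter>A"
  have Inf: "\<Sqinter>A \<in> carrier L"
    using A by simp
  then have c: "?c \<in> carrier L" "?c \<sqsubseteq> b" "?c \<sqsubseteq> \<Sqinter>A"
    using b by (simp_all add: meet_left meet_right)
  have c_le: "?c \<sqsubseteq> a" if "a \<in> A" for a
    using inf_lower[OF A(1) that] c Inf A that by (blast intro: le_trans[of _ "\<Sqinter>A"])
  have JL: "(\<lambda>a. a \<rightarrow> d) ` A \<subseteq> carrier L" for d
    by auto
  have "(\<Sqinter>A) \<rightarrow> b \<sqsubseteq> (\<Sqinter>A) \<rightarrow> ?c"
    using heyting_imp_le_imp_meet b Inf by simp
  \<comment> \<open>Since \<open>?c\<close> is below every member of \<open>A\<close>, the family
    lies in the closed sublocale of \<open>?c\<close>, and \<open>closed\<close> applies with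
    \<open>?c\<close> in the role of \<open>b\<close>.\<close>
  also have "(\<Sqinter>A) \<rightarrow> ?c \<sqsubseteq> \<Squnion>((\<lambda>a. a \<rightarrow> ?c) ` A)"
    using A c c_le by (intro closed) (auto simp: closed_sublocale_def)
  also have "\<Squnion>((\<lambda>a. a \<rightarrow> ?c) ` A) \<sqsubseteq> \<Squnion>((\<lambda>a. a \<rightarrow> b) ` A)"
  proof (rule sup_least[OF JL sup_closed[OF JL]])
    fix x
    assume "x \<in> (\<lambda>a. a \<rightarrow> ?c) ` A"
    then obtain a where a: "a \<in> A" "x = a \<rightarrow> ?c"
      by blast
    have "x \<sqsubseteq> a \<rightarrow> b"
      unfolding a(2) using a A b c by (intro heyting_imp_mono) auto
    moreover have "a \<rightarrow> b \<sqsubseteq> \<Squnion>((\<lambda>a. a \<rightarrow> b) ` A)"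
      using a by (intro sup_upper[OF JL]) blast
    ultimately show "x \<sqsubseteq> \<Squnion>((\<lambda>a. a \<rightarrow> b) ` A)"
      using a(2) sup_closed[OF JL] by (blast intro: le_trans[of _ "a \<rightarrow> b"])
  qed
  finally show ?thesis
    using sup_closed[OF JL] by simp
qed

end

theorem proposition6p5:
  fixes L :: "('a, 'b) gorder_scheme" (structure)
  assumes "frame L"
  shows
    "(hereditarily_IDM L \<longleftrightarrow>
       (\<forall>b \<in> carrier L. \<forall>A \<subseteq> carrier L. A \<noteq> {} \<longrightarrow>
          (\<Sqinter>A) \<rightarrow> b \<sqsubseteq> \<Squnion>((\<lambda>a. a \<rightarrow> b) ` A))) \<and>
     (hereditarily_IDM L \<longleftrightarrow>
       (\<forall>b \<in> carrier L. \<forall>A \<subseteq> closed_sublocale L b. A \<noteq> {} \<longrightarrow>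
          (\<Sqinter>A) \<rightarrow> b \<sqsubseteq> \<Squnion>((\<lambda>a. a \<rightarrow> b) ` A)))"
    (is "(?i \<longleftrightarrow> ?ii) \<and> (?i \<longleftrightarrow> ?iii)")
proof -
  interpret frame L
    by (rule assms)
  \<comment> \<open>The equivalences follow from the cycle \<open>?i\<close> to \<open>?iii\<close>
    to \<open>?ii\<close> to \<open>?i\<close>.\<close>
  have "?iii" if ?i
    using that unfolding hereditarily_IDM_def
    by (intro ballI allI impI IDM_closed_sublocaleD) (simp_all add: is_sublocale_closed_sublocale)
  moreover have "?ii" if ?iii
    by (intro ballI allI impI, rule Inf_imp_le_of_closed_sublocales) (use that in auto)
  moreover have "?i" if ?ii
    unfolding hereditarily_IDM_def
  proof (intro allI impI)
    fix S
    assume "is_sublocale L S"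
    then interpret frame_sublocale L S
      by unfold_locales
    show "IDM M"
      using that by (intro IDM_sub) simp
  qed
  ultimately show ?thesis
    by blast
qed

end
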